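(* Let $r\in[1,\infty)$ and let $(b_n)_{n=1}^\infty$ be a sequence of positive real numbers such that the sequence $\big(\frac n{b_n}\big)_{n=1}^\infty$ is unbounded. For each positive integer $n$ let $E_n:=\{y\in\mathbb I^n:|y|\geqslant n-b_n\}$. Then $$\sup_{n\geqslant 1}\ \sup_{\substack{f\in\mathbb C^{\mathbb I^n}\setminus\{0\}\\ \widehat f(y)=0\text{ for all }y\in E_n}}\frac{\|V_r(S_kf:k\in\{0,\dots,n\})\|_2}{\|f\|_2}=\infty.$$
   Context: For a positive integer $n$, $\mathbb I^n:=\{0,1\}^n$ is the hypercube with the Hamming metric $d(x,y):=|\{j:x(j)\neq y(j)\}|$, and $|x|:=\sum_{j=1}^nx(j)$ for $x\in\mathbb I^n$. For $k\in\{0,\dots,n\}$ and $f:\mathbb I^n\to\mathbb C$, the spherical mean is $$S_kf(x):=\frac1{\binom nk}\sum_{y\in\mathbb I^n,\ d(x,y)=k}f(y),\qquad x\in\mathbb I^n.$$ The norm is $\|f\|_2:=\big(\sum_{x\in\mathbb I^n}|f(x)|^2\big)^{1/2}$. The Fourier transform of $f:\mathbb I^n\to\mathbb C$ is $\widehat f(y):=\frac1{\sqrt{2^n}}\sum_{x\in\mathbb I^n}f(x)(-1)^{x\cdot y}$ for $y\in\mathbb I^n$, where $x\cdot y=\sum_{j=1}^nx(j)y(j)$. For $r\in[1,\infty)$, $Z\subseteq\{0,\dots,n\}$ and $x\in\mathbb I^n$, the $r$-variation seminorm is $$V_r(S_kf(x):k\in Z):=\sup_{k_0<k_1<\dots<k_J,\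 k_j\in Z}\Big(\sum_{j=1}^J|S_{k_{j-1}}f(x)-S_{k_j}f(x)|^r\Big)^{1/r},$$ the supremum being over all finite nonempty strictly increasing sequences in $Z$. $V_r(S_kf:k\in Z)$ denotes the function $\mathbb I^n\ni x\mapsto V_r(S_kf(x):k\in Z)$. Suprema are taken in $[0,\infty]$, so $\sup\emptyset=0$ (relevant for those $n$ with $E_n=\mathbb I^n$). *)

theory Defs
  imports "HOL-Analysis.Analysis" "HOL-Library.Extended_Nonnegative_Real" "HOL-Library.FuncSet"
begin

(* The dimension n varies inside the theorem, so points of {0,1}^n are extensional
   functions on the coordinate set {1..n}. *)
definition cube :: "nat \<Rightarrow> (nat \<Rightarrow> nat) set" where
  "cube n = {1..n} \<rightarrow>\<^sub>E {0, 1}"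

definition hamming_dist :: "nat \<Rightarrow> (nat \<Rightarrow> nat) \<Rightarrow> (nat \<Rightarrow> nat) \<Rightarrow> nat" where
  "hamming_dist n x y = card {j \<in> {1..n}. x j \<noteq> y j}"

definition weight :: "nat \<Rightarrow> (nat \<Rightarrow> nat) \<Rightarrow> nat" where
  "weight n x = (\<Sum>j=1..n. x j)"

definition cube_dot :: "nat \<Rightarrow> (nat \<Rightarrow> nat) \<Rightarrow> (nat \<Rightarrow> nat) \<Rightarrow> nat" where
  "cube_dot n x y = (\<Sum>j=1..n. x j * y j)"

definition spherical_mean ::
    "nat \<Rightarrow> nat \<Rightarrow> ((nat \<Rightarrow> nat) \<Rightarrow> complex) \<Rightarrow> (nat \<Rightarrow> nat) \<Rightarrow> complex" where
  "spherical_mean n k f x =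
     1 / of_nat (n choose k) * (\<Sum>y \<in> {y \<in> cube n. hamming_dist n x y = k}. f y)"

definition cube_fourier ::
    "nat \<Rightarrow> ((nat \<Rightarrow> nat) \<Rightarrow> complex) \<Rightarrow> (nat \<Rightarrow> nat) \<Rightarrow> complex" where
  "cube_fourier n f y =
     1 / complex_of_real (sqrt (2 ^ n)) * (\<Sum>x \<in> cube n. f x * (- 1) ^ cube_dot n x y)"

definition l2_norm :: "nat \<Rightarrow> ((nat \<Rightarrow> nat) \<Rightarrow> 'a::real_normed_vector) \<Rightarrow> real" where
  "l2_norm n f = sqrt (\<Sum>x \<in> cube n. (norm (f x))\<^sup>2)"

(* The r-variation seminorm of the family (a k : k \<in> Z).  A pair (J, k) encodes the
   sequence k 0 < ... < k J; values of k beyond J are irrelevant.  The supremum is taken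
   in [0, \<infinity>], so it is 0 for empty Z.  For finite Z it ranges over finitely many
   values and is finite, so enn2real loses nothing; Z is only ever a subset of {0..n}. *)
definition variation :: "real \<Rightarrow> nat set \<Rightarrow> (nat \<Rightarrow> complex) \<Rightarrow> real" where
  "variation r Z a = enn2real
     (SUP (J, k) \<in> {(J :: nat, k). strict_mono_on {0..J} k \<and> k ` {0..J} \<subseteq> Z}.
        ennreal ((\<Sum>j=1..J. cmod (a (k (j - 1)) - a (k j)) powr r) powr (1 / r)))"

definition high_freq :: "(nat \<Rightarrow> real) \<Rightarrow> nat \<Rightarrow> (nat \<Rightarrow> nat) set" where
  "high_freq b n = {y \<in> cube n. real (weight n y) \<ge> real n - b n}"

(* Nonzero elements of the space of functions {0,1}^n \<rightarrow> \<complex> (extensional representatives,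
   so being nonzero is tested on the cube) with Fourier transform vanishing on E. *)
definition admissible :: "nat \<Rightarrow> (nat \<Rightarrow> nat) set \<Rightarrow> ((nat \<Rightarrow> nat) \<Rightarrow> complex) set" where
  "admissible n E =
     {f \<in> cube n \<rightarrow>\<^sub>E UNIV. (\<exists>x \<in> cube n. f x \<noteq> 0) \<and> (\<forall>y \<in> E. cube_fourier n f y = 0)}"

end

(* Test the inequality on a single character f(x) = (-1)^(x.y), where y has exactly m zeros
   and m is the least integer larger than b_n.  Every S_k acts on f as multiplication by
   (-1)^k p_k, where p_k is the average of (-1)^|A \<inter> M| over all k-subsets A of {1..n} and M
   is the zero set of y.  By the first moment bound, p_k \<ge> 1 - 2km/n, which is at least 1/2
   for k \<le> n/(4m).  In this range consecutive means have opposite signs and differ by at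
   least 1, so the r-variation is at least (n/(4m))^(1/r) up to rounding, and this is
   unbounded in n. *)
theory Submission
  imports Defs
begin

section \<open>Characters of the cube and their spherical means\<close>

definition walsh :: "nat \<Rightarrow> (nat \<Rightarrow> nat) \<Rightarrow> (nat \<Rightarrow> nat) \<Rightarrow> complex" where
  "walsh n y = restrict (\<lambda>x. (- 1) ^ cube_dot n x y) (cube n)"

text \<open>\<open>A\<close> is the set of coordinates to be changed. On 0/1 values the truncated
  \<open>1 - x j\<close> is the complement, and \<open>restrict\<close> keeps the result
  extensional, hence a point of the cube.\<close>

definition flip :: "nat \<Rightarrow> (nat \<Rightarrow> nat) \<Rightarrow> nat set \<Rightarrow> nat \<Rightarrow> nat" where
  "flip n x A = restrict (\<lambda>j. if j \<in> A then 1 - x j else x j) {1..n}"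

lemma finite_cube [simp]: "finite (cube n)"
  unfolding cube_def by (intro finite_PiE) auto

lemma cube_nonempty: "cube n \<noteq> {}"
  unfolding cube_def by (simp add: PiE_eq_empty_iff)

lemma cube_coord: "x \<in> cube n \<Longrightarrow> j \<in> {1..n} \<Longrightarrow> x j = 0 \<or> x j = 1"
  unfolding cube_def using PiE_mem by fastforce

lemma cube_eqI:
  assumes "x \<in> cube n" "y \<in> cube n" "\<And>j. j \<in> {1..n} \<Longrightarrow> x j = y j"
  shows "x = y"
  using assms unfolding cube_def by (rule PiE_ext)

lemma flip_in_cube:
  assumes "x \<in> cube n"
  shows "flip n x A \<in> cube n"
proof -
  have "(if j \<in> A then 1 - x j else x j) \<in> {0, 1}" if "j \<in> {1..n}" for j
    using cube_coord[OF assms that] by auto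
  then show ?thesis
    unfolding cube_def flip_def by (simp only: restrict_PiE_iff) blast
qed

lemma flip_neq_iff:
  assumes "x \<in> cube n" "j \<in> {1..n}"
  shows "x j \<noteq> flip n x A j \<longleftrightarrow> j \<in> A"
  using cube_coord[OF assms] assms(2) by (auto simp: flip_def)

text \<open>A point of the sphere around \<open>x\<close> is determined by the set of coordinates
  where it differs from \<open>x\<close>. The new index set does not depend on \<open>x\<close>,
  which is what turns the mean of a character into a multiplier.\<close>

lemma sum_sphere_eq:
  assumes x: "x \<in> cube n"
  shows "(\<Sum>z \<in> {z \<in> cube n. hamming_dist n x z = k}. g z) =
         (\<Sum>A \<in> {A. A \<subseteq> {1..n} \<and> card A = k}. g (flip n x A))"
proof (rule sum.reindex_bij_witness[where i = "flip n x" and j = "\<lambda>z. {j \<in> {1..n}. x j \<noteq> z j}"])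
  fix z assume "z \<in> {z \<in> cube n. hamming_dist n x z = k}"
  then have z: "z \<in> cube n" and k: "card {j \<in> {1..n}. x j \<noteq> z j} = k"
    by (auto simp: hamming_dist_def)
  show eq: "flip n x {j \<in> {1..n}. x j \<noteq> z j} = z"
  proof (rule cube_eqI[OF flip_in_cube[OF x] z])
    fix j assume j: "j \<in> {1..n}"
    show "flip n x {j \<in> {1..n}. x j \<noteq> z j} j = z j"
      using cube_coord[OF x j] cube_coord[OF z j] j by (auto simp: flip_def)
  qed
  show "{j \<in> {1..n}. x j \<noteq> z j} \<in> {A. A \<subseteq> {1..n} \<and> card A = k}"
    using k by auto
  show "g (flip n x {j \<in> {1..n}. x j \<noteq> z j}) = g z"
    by (simp only: eq)
next
  fix A assume "A \<in> {A. A \<subseteq> {1..n} \<and> card A = k}"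
  then have A: "A \<subseteq> {1..n}" "card A = k" by auto
  show eq: "{j \<in> {1..n}. x j \<noteq> flip n x A j} = A"
    using flip_neq_iff[OF x] A(1) by blast
  show "flip n x A \<in> {z \<in> cube n. hamming_dist n x z = k}"
    unfolding mem_Collect_eq hamming_dist_def eq using flip_in_cube[OF x] A(2) by simp
qed

text \<open>Flipping coordinate \<open>j\<close> switches \<open>x j * y j\<close> between 0 and
  \<open>y j\<close>, so it costs the sign \<open>(- 1) ^ y j\<close> whatever \<open>x j\<close>
  was.\<close>

lemma walsh_flip:
  assumes x: "x \<in> cube n" and A: "A \<subseteq> {1..n}"
  shows "walsh n y (flip n x A) = walsh n y x * (\<Prod>j\<in>A. (- 1) ^ y j)"
proof -
  have "(- 1 :: complex) ^ (flip n x A j * y j) =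
        (- 1) ^ (x j * y j) * (if j \<in> A then (- 1) ^ y j else 1)" if "j \<in> {1..n}" for j
    using cube_coord[OF x that] that by (auto simp: flip_def simp flip: power_mult_distrib)
  then have "(- 1 :: complex) ^ cube_dot n (flip n x A) y =
        (\<Prod>j=1..n. (- 1) ^ (x j * y j) * (if j \<in> A then (- 1) ^ y j else 1))"
    by (simp only: cube_dot_def power_sum cong: prod.cong)
  also have "\<dots> = (- 1) ^ cube_dot n x y * (\<Prod>j=1..n. if j \<in> A then (- 1) ^ y j else 1)"
    by (simp add: prod.distrib cube_dot_def power_sum)
  also have "(\<Prod>j=1..n. if j \<in> A then (- 1 :: complex) ^ y j else 1) = (\<Prod>j\<in>A. (- 1) ^ y j)"
    using A by (simp add: prod.inter_restrict[symmetric] Int_absorb1)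
  finally show ?thesis
    using x flip_in_cube[OF x] by (simp add: walsh_def)
qed

text \<open>Characters are eigenfunctions of every spherical mean; the eigenvalue is a normalized
  Krawtchouk polynomial at the weight of \<open>y\<close>, written as an average over
  \<open>k\<close>-subsets.\<close>

lemma spherical_mean_walsh:
  assumes "x \<in> cube n"
  shows "spherical_mean n k (walsh n y) x = walsh n y x *
    (1 / of_nat (n choose k) * (\<Sum>A \<in> {A. A \<subseteq> {1..n} \<and> card A = k}. \<Prod>j\<in>A. (- 1) ^ y j))"
  unfolding spherical_mean_def sum_sphere_eq[OF assms]
  by (simp add: walsh_flip[OF assms] sum_distrib_left[symmetric])

text \<open>Orthogonality of characters: the sum over the cube factors over the coordinates, and a
  coordinate where \<open>y\<close> and \<open>z\<close> differ contributes 1 + (-1) = 0.\<close>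

lemma cube_fourier_walsh_eq_0:
  assumes y: "y \<in> cube n" and z: "z \<in> cube n" and "z \<noteq> y"
  shows "cube_fourier n (walsh n y) z = 0"
proof -
  obtain i where i: "i \<in> {1..n}" "z i \<noteq> y i"
    using cube_eqI[OF z y] \<open>z \<noteq> y\<close> by blast
  have "(\<Sum>x\<in>cube n. walsh n y x * (- 1) ^ cube_dot n x z) =
        (\<Sum>x\<in>cube n. \<Prod>j=1..n. (- 1 :: complex) ^ (x j * (y j + z j)))"
    by (intro sum.cong refl)
      (simp add: walsh_def cube_dot_def power_sum prod.distrib power_add distrib_left)
  also have "\<dots> = (\<Prod>j=1..n. \<Sum>v\<in>{0, 1}. (- 1 :: complex) ^ (v * (y j + z j)))"
    unfolding cube_def by (subst prod_sum_PiE) auto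
  also have "\<dots> = 0"
  proof (rule prod_zero)
    have "(\<Sum>v\<in>{0, 1}. (- 1 :: complex) ^ (v * (y i + z i))) = 0"
      using i cube_coord[OF y i(1)] cube_coord[OF z i(1)] by auto
    then show "\<exists>j\<in>{1..n}. (\<Sum>v\<in>{0, 1}. (- 1 :: complex) ^ (v * (y j + z j))) = 0"
      using i(1) by blast
  qed simp
  finally show ?thesis
    by (simp add: cube_fourier_def)
qed

lemma norm_walsh: "x \<in> cube n \<Longrightarrow> cmod (walsh n y x) = 1"
  by (simp add: walsh_def norm_power)

lemma walsh_admissible:
  assumes "y \<in> cube n" "E \<subseteq> cube n" "y \<notin> E"
  shows "walsh n y \<in> admissible n E"
proof -
  obtain x where "x \<in> cube n"
    using cube_nonempty by blast
  then have "\<exists>x\<in>cube n. walsh n y x \<noteq> 0"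
    by (auto simp: walsh_def)
  moreover have "\<forall>z\<in>E. cube_fourier n (walsh n y) z = 0"
    using assms by (metis cube_fourier_walsh_eq_0 subsetD)
  moreover have "walsh n y \<in> cube n \<rightarrow>\<^sub>E UNIV"
    by (simp add: walsh_def)
  ultimately show ?thesis
    by (simp add: admissible_def)
qed

section \<open>Averaging signs over the subsets of a given size\<close>

lemma card_subsets_containing:
  assumes "finite S" "i \<in> S" "k \<ge> 1"
  shows "card {A. A \<subseteq> S \<and> card A = k \<and> i \<in> A} = (card S - 1) choose (k - 1)"
proof -
  have "bij_betw (insert i) {B. B \<subseteq> S - {i} \<and> card B = k - 1} {A. A \<subseteq> S \<and> card A = k \<and> i \<in> A}"
  proof (rule bij_betw_byWitness[where f' = "\<lambda>A. A - {i}"])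
    show "insert i ` {B. B \<subseteq> S - {i} \<and> card B = k - 1} \<subseteq> {A. A \<subseteq> S \<and> card A = k \<and> i \<in> A}"
    proof clarify
      fix B assume B: "B \<subseteq> S - {i}" "card B = k - 1"
      then have "finite B" "i \<notin> B"
        using assms(1) by (auto intro: finite_subset)
      then show "insert i B \<subseteq> S \<and> card (insert i B) = k \<and> i \<in> insert i B"
        using B assms(2,3) by auto
    qed
  qed (auto simp: card_Diff_singleton)
  then show ?thesis
    using n_subsets[of "S - {i}" "k - 1"] assms(1,2) bij_betw_same_card by fastforce
qed

text \<open>Double counting of the pairs of a \<open>k\<close>-subset \<open>A\<close> and an
  element of \<open>A \<inter> M\<close>. The factor \<open>card S\<close> clears the denominator of
  the mean \<open>k * card M / card S\<close>, so the identity can be stated in the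
  naturals.\<close>

lemma sum_card_Int_subsets:
  assumes "finite S" "M \<subseteq> S"
  shows "card S * (\<Sum>A \<in> {A. A \<subseteq> S \<and> card A = k}. card (A \<inter> M)) =
         k * card M * (card S choose k)"
proof (cases "k = 0 \<or> S = {}")
  case True
  have "card (A \<inter> M) = 0" if "A \<subseteq> S" "card A = k" for A
    using True that assms finite_subset by fastforce
  then show ?thesis
    using True assms(2) by auto
next
  case False
  have fin: "finite {A. A \<subseteq> S \<and> card A = k}" "finite M"
    using assms finite_subset by auto
  have "(\<Sum>A \<in> {A. A \<subseteq> S \<and> card A = k}. card (A \<inter> M)) =
        (\<Sum>A \<in> {A. A \<subseteq> S \<and> card A = k}. \<Sum>i\<in>M. if i \<in> A then 1 else 0)"
    using fin by (simp add: sum.If_cases Int_commute)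
  also have "\<dots> = (\<Sum>i\<in>M. \<Sum>A \<in> {A. A \<subseteq> S \<and> card A = k}. if i \<in> A then 1 else 0)"
    by (rule sum.swap)
  also have "\<dots> = (\<Sum>i\<in>M. card {A. A \<subseteq> S \<and> card A = k \<and> i \<in> A})"
    using fin by (simp add: sum.If_cases Collect_conj_eq[symmetric] conj_assoc)
  also have "\<dots> = (\<Sum>i\<in>M. (card S - 1) choose (k - 1))"
    using card_subsets_containing[OF assms(1)] assms(2) False
    by (intro sum.cong) auto
  finally have "card S * (\<Sum>A \<in> {A. A \<subseteq> S \<and> card A = k}. card (A \<inter> M)) =
      card M * (card S * ((card S - 1) choose (k - 1)))"
    by simp
  also have "card S * ((card S - 1) choose (k - 1)) = k * (card S choose k)"
    using times_binomial_minus1_eq[of k "card S"] False by simp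
  finally show ?thesis
    by (simp add: ac_simps)
qed

text \<open>The first moment bound: average the pointwise inequality (-1)^j >= 1 - 2j, an equality
  for j = 0 and j = 1, with \<open>j = card (A \<inter> M)\<close>, whose mean is given by the
  double count.\<close>

lemma sum_sign_subsets_ge:
  fixes S M :: "'a set"
  assumes S: "finite S" "S \<noteq> {}" and "M \<subseteq> S" and k: "k \<le> card S"
  shows "(\<Sum>A \<in> {A. A \<subseteq> S \<and> card A = k}. (- 1) ^ card (A \<inter> M)) / real (card S choose k)
           \<ge> 1 - 2 * real k * real (card M) / real (card S)"
proof -
  let ?F = "{A. A \<subseteq> S \<and> card A = k}"
  have c: "real (card S choose k) > 0" and n: "real (card S) > 0"
    using k S by (simp_all add: card_gt_0_iff)
  have sign: "1 - 2 * real j \<le> (- 1) ^ j" for j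
    by (cases "even j"; cases "j = 0") auto
  have "real (card S) * (\<Sum>A\<in>?F. real (card (A \<inter> M))) =
      real (card S * (\<Sum>A\<in>?F. card (A \<inter> M)))"
    by simp
  also have "\<dots> = real k * real (card M) * real (card S choose k)"
    unfolding sum_card_Int_subsets[OF S(1) \<open>M \<subseteq> S\<close>] by simp
  finally have "(\<Sum>A\<in>?F. real (card (A \<inter> M))) =
      real (card S choose k) * (real k * real (card M) / real (card S))"
    using n by (simp add: field_simps)
  then have "(1 - 2 * real k * real (card M) / real (card S)) * real (card S choose k) =
      (\<Sum>A\<in>?F. 1 - 2 * real (card (A \<inter> M)))"
    using n_subsets[OF S(1), of k]
    by (simp add: sum_subtractf sum_distrib_left[symmetric] algebra_simps)
  also have "\<dots> \<le> (\<Sum>A\<in>?F. (- 1) ^ card (A \<inter> M))"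
    by (intro sum_mono sign)
  finally show ?thesis
    using c by (simp add: pos_le_divide_eq)
qed

section \<open>Lower bounds for the variation\<close>

lemma strict_mono_on_length_le:
  fixes k :: "nat \<Rightarrow> nat"
  assumes "strict_mono_on {0..J} k" "k ` {0..J} \<subseteq> {0..n}"
  shows "J \<le> n"
proof -
  have "card (k ` {0..J}) = Suc J"
    using strict_mono_on_imp_inj_on[OF assms(1)] by (simp add: card_image)
  then show ?thesis
    using card_mono[OF _ assms(2)] by simp
qed

text \<open>Finiteness of the supremum has to be checked, because \<open>enn2real\<close> maps infinity to 0.\<close>

lemma variation_ge:
  fixes k :: "nat \<Rightarrow> nat"
  assumes r: "r > 0" and J: "strict_mono_on {0..J} k" "k ` {0..J} \<subseteq> {0..n}"
  shows "variation r {0..n} a \<ge> (\<Sum>j=1..J. cmod (a (k (j - 1)) - a (k j)) powr r) powr (1 / r)"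
proof -
  define g where "g = (\<lambda>(J :: nat, k :: nat \<Rightarrow> nat). ennreal ((\<Sum>j=1..J. cmod (a (k (j - 1)) - a (k j)) powr r) powr (1 / r)))"
  define P where "P = {(J :: nat, k :: nat \<Rightarrow> nat). strict_mono_on {0..J} k \<and> k ` {0..J} \<subseteq> {0..n}}"
  \<comment> \<open>A crude bound for every difference of two values of \<open>a\<close>, twice a
    bound for the single values. As a chain in \<open>{0..n}\<close> has at most \<open>n\<close>
    jumps, it bounds all competitors in the supremum at once.\<close>
  define B where "B = 2 * (\<Sum>i=0..n. cmod (a i))"
  have var: "variation r {0..n} a = enn2real (SUP p\<in>P. g p)"
    unfolding variation_def g_def P_def by simp
  have a_le: "cmod (a i) \<le> B / 2" if "i \<le> n" for i
    using member_le_sum[of i "{0..n}" "\<lambda>i. cmod (a i)"] that by (simp add: B_def)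
  have "g p \<le> ennreal ((real n * B powr r) powr (1 / r))" if "p \<in> P" for p
  proof -
    obtain J k where p: "p = (J, k)" and k: "strict_mono_on {0..J} k" "k ` {0..J} \<subseteq> {0..n}"
      using \<open>p \<in> P\<close> by (auto simp: P_def)
    have "cmod (a (k (j - 1)) - a (k j)) powr r \<le> B powr r" if "j \<in> {1..J}" for j
    proof (rule powr_mono2)
      have "k (j - 1) \<le> n" "k j \<le> n"
        using k(2) that by (auto simp: image_subset_iff)
      then show "cmod (a (k (j - 1)) - a (k j)) \<le> B"
        using a_le[of "k (j - 1)"] a_le[of "k j"] norm_triangle_ineq4[of "a (k (j - 1))" "a (k j)"]
        by linarith
    qed (use r in auto)
    then have "(\<Sum>j=1..J. cmod (a (k (j - 1)) - a (k j)) powr r) \<le> real J * B powr r"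
      using sum_bounded_above[of "{1..J}" _ "B powr r"] by simp
    also have "\<dots> \<le> real n * B powr r"
      using strict_mono_on_length_le[OF k] by (intro mult_right_mono) auto
    finally show ?thesis
      using r by (auto simp: g_def p intro!: ennreal_leI powr_mono2 sum_nonneg)
  qed
  then have "(SUP p\<in>P. g p) \<le> ennreal ((real n * B powr r) powr (1 / r))"
    by (rule SUP_least)
  then have fin: "(SUP p\<in>P. g p) < top"
    using ennreal_less_top le_less_trans by blast
  have "g (J, k) \<le> (SUP p\<in>P. g p)"
    using J by (intro SUP_upper) (simp add: P_def)
  from enn2real_mono[OF this fin] show ?thesis
    by (simp add: var g_def)
qed

text \<open>The competitor is the chain 0 < 1 < ... < J. A jump of size at least 1 stays at least 1
  after raising to the power \<open>r\<close>.\<close>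

lemma variation_ge_steps:
  assumes "r > 0" "J \<le> n" and step: "\<And>j. 1 \<le> j \<Longrightarrow> j \<le> J \<Longrightarrow> cmod (a (j - 1) - a j) \<ge> 1"
  shows "variation r {0..n} a \<ge> real J powr (1 / r)"
proof -
  have "real J = (\<Sum>j=1..J. 1)"
    by simp
  also have "\<dots> \<le> (\<Sum>j=1..J. cmod (a (j - 1) - a j) powr r)"
    using \<open>r > 0\<close> step by (intro sum_mono ge_one_powr_ge_zero) auto
  finally have "real J powr (1 / r) \<le> (\<Sum>j=1..J. cmod (a (j - 1) - a j) powr r) powr (1 / r)"
    using \<open>r > 0\<close> by (intro powr_mono2) auto
  also have "\<dots> \<le> variation r {0..n} a"
    using variation_ge[of r J "\<lambda>j. j" n a] assms(1,2) by (auto simp: strict_mono_on_def)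
  finally show ?thesis .
qed

section \<open>The variation of a test character\<close>

lemma variation_walsh_ge:
  assumes "r > 0" "1 \<le> m" "1 \<le> N" "4 * N * m \<le> n" and x: "x \<in> cube n"
    and y: "y = restrict (\<lambda>j. if j \<le> m then 0 else 1) {1..n}"
  shows "variation r {0..n} (\<lambda>k. spherical_mean n k (walsh n y) x) \<ge> real N powr (1 / r)"
proof -
  \<comment> \<open>The eigenvalue of the \<open>k\<close>-th mean with its sign
    \<open>(- 1) ^ k\<close> split off; \<open>{1..m}\<close> is the zero set of
    \<open>y\<close>.\<close>
  define p where "p k = (\<Sum>A \<in> {A. A \<subseteq> {1..n} \<and> card A = k}. (- 1) ^ card (A \<inter> {1..m}))
    / real (n choose k)" for k
  have "4 * N \<le> 4 * N * m" "m \<le> 4 * N * m"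
    using assms(2,3) by simp_all
  then have le: "N \<le> n" "m \<le> n" "n > 0"
    using assms(2-4) by linarith+
  have mean: "spherical_mean n k (walsh n y) x = walsh n y x * of_real ((- 1) ^ k * p k)" for k
  proof -
    have "(\<Prod>j\<in>A. (- 1 :: complex) ^ y j) = (- 1) ^ k * (- 1) ^ card (A \<inter> {1..m})"
      if A: "A \<subseteq> {1..n}" "card A = k" for A
    proof -
      have "finite A"
        using A finite_subset by blast
      \<comment> \<open>Every coordinate is given the sign -1 first, and the second factor corrects
        this on the zeros of \<open>y\<close>.\<close>
      have "(\<Prod>j\<in>A. (- 1 :: complex) ^ y j) = (\<Prod>j\<in>A. - 1 * (if j \<in> {1..m} then - 1 else 1))"
        using A by (intro prod.cong) (auto simp: y)
      also have "\<dots> = (- 1) ^ k * (\<Prod>j\<in>A. if j \<in> {1..m} then - 1 else 1)"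
        using A by (simp only: prod.distrib prod_constant)
      also have "(\<Prod>j\<in>A. if j \<in> {1..m} then - 1 else 1 :: complex) = (- 1) ^ card (A \<inter> {1..m})"
        using \<open>finite A\<close> by (simp only: prod.inter_restrict[symmetric] prod_constant)
      finally show ?thesis .
    qed
    then have "(\<Sum>A \<in> {A. A \<subseteq> {1..n} \<and> card A = k}. \<Prod>j\<in>A. (- 1 :: complex) ^ y j) =
        (- 1) ^ k * (\<Sum>A \<in> {A. A \<subseteq> {1..n} \<and> card A = k}. (- 1) ^ card (A \<inter> {1..m}))"
      unfolding sum_distrib_left by (intro sum.cong) auto
    then show ?thesis
      by (simp add: spherical_mean_walsh[OF x] p_def)
  qed
  have p_ge: "p k \<ge> 1 / 2" if "k \<le> N" for k
  proof -
    have "4 * k * m \<le> n"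
      using that by (intro order_trans[OF _ assms(4)] mult_le_mono) auto
    then have "4 * real k * real m \<le> real n"
      by (metis of_nat_le_iff of_nat_mult of_nat_numeral)
    then have "2 * real k * real m / real n \<le> 1 / 2"
      using le by (simp add: field_simps)
    moreover have "p k \<ge> 1 - 2 * real k * real m / real n"
      using sum_sign_subsets_ge[of "{1..n}" "{1..m}" k] le that by (simp add: p_def)
    ultimately show ?thesis
      by linarith
  qed
  show ?thesis
  proof (rule variation_ge_steps[OF \<open>r > 0\<close> \<open>N \<le> n\<close>])
    fix j assume j: "1 \<le> j" "j \<le> N"
    then obtain i where i: "j = Suc i"
      by (cases j) auto
    \<comment> \<open>Neighbouring eigenvalues have opposite signs, so the difference turns into the
      sum \<open>p i + p j\<close>, which is at least 1/2 + 1/2.\<close>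
    have "spherical_mean n (j - 1) (walsh n y) x - spherical_mean n j (walsh n y) x =
        walsh n y x * of_real ((- 1) ^ i * (p i + p j))"
      by (simp add: mean i algebra_simps)
    then have "cmod (spherical_mean n (j - 1) (walsh n y) x - spherical_mean n j (walsh n y) x) =
        \<bar>p i + p j\<bar>"
      by (simp only: norm_mult norm_walsh[OF x] norm_of_real) (simp add: abs_mult)
    also have "\<dots> \<ge> 1"
      using p_ge[of i] p_ge[of j] j i by linarith
    finally show "1 \<le> cmod (spherical_mean n (j - 1) (walsh n y) x - spherical_mean n j (walsh n y) x)" .
  qed
qed

section \<open>Norms, choice of the dimension and conclusion\<close>

lemma l2_norm_walsh: "l2_norm n (walsh n y) = sqrt (real (card (cube n)))"
  by (simp add: l2_norm_def norm_walsh)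

text \<open>The factor \<open>sqrt (real (card (cube n)))\<close> is also the norm of a character,
  so it cancels in the quotient and a pointwise bound on the variation becomes a bound on the ratio
  of norms.\<close>

lemma l2_norm_ge:
  fixes g :: "(nat \<Rightarrow> nat) \<Rightarrow> real"
  assumes "c \<ge> 0" "\<And>x. x \<in> cube n \<Longrightarrow> g x \<ge> c"
  shows "l2_norm n g \<ge> c * sqrt (real (card (cube n)))"
proof -
  have "real (card (cube n)) * c\<^sup>2 \<le> (\<Sum>x\<in>cube n. (norm (g x))\<^sup>2)"
  proof -
    have "(\<Sum>x\<in>cube n. c\<^sup>2) \<le> (\<Sum>x\<in>cube n. (norm (g x))\<^sup>2)"
      using assms by (intro sum_mono power_mono) (auto intro: order_trans[OF _ abs_ge_self])
    then show ?thesis by simp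
  qed
  then have "sqrt (real (card (cube n)) * c\<^sup>2) \<le> l2_norm n g"
    unfolding l2_norm_def by (rule real_sqrt_le_mono)
  then show ?thesis
    using assms(1) by (simp add: real_sqrt_mult mult.commute)
qed

text \<open>Removing finitely many terms keeps a sequence unbounded, and nonnegativity forces it to
  be unbounded from above. The threshold \<open>K\<close> allows the dimension itself to be taken
  large as well.\<close>

lemma unbounded_image_large:
  fixes g :: "nat \<Rightarrow> real"
  assumes "\<not> bounded (g ` {1..})" and "\<And>n. n \<ge> 1 \<Longrightarrow> g n \<ge> 0"
  obtains n where "n \<ge> K" "n \<ge> 1" "g n > B"
proof -
  have "\<exists>n\<ge>K. n \<ge> 1 \<and> g n > B"
  proof (rule ccontr)
    assume "\<not> ?thesis"
    then have le: "g n \<le> B" if "n \<ge> K" "n \<ge> 1" for n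
      using that by force
    have "g ` {1..} \<subseteq> g ` {..K} \<union> {0..B}"
    proof
      fix v assume "v \<in> g ` {1..}"
      then obtain n where n: "v = g n" "n \<ge> 1"
        by auto
      show "v \<in> g ` {..K} \<union> {0..B}"
        using le[of n] assms(2)[of n] n by (cases "n \<le> K") auto
    qed
    moreover have "bounded (g ` {..K} \<union> {0..B})"
      by (simp add: finite_imp_bounded)
    ultimately show False
      using assms(1) bounded_subset by blast
  qed
  then show ?thesis
    using that by blast
qed

theorem corollary3p5:
  fixes r :: real and b :: "nat \<Rightarrow> real"
  assumes "r \<ge> 1"
    and "\<And>n. n \<ge> 1 \<Longrightarrow> b n > 0"
    and "\<not> bounded ((\<lambda>n. real n / b n) ` {1..})"
  shows "(SUP n \<in> {1..}. SUP f \<in> admissible n (high_freq b n).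
            ennreal (l2_norm n (\<lambda>x. variation r {0..n} (\<lambda>k. spherical_mean n k f x))
                     / l2_norm n f)) = \<infinity>"
    (is "?S = \<infinity>")
proof (rule ccontr)
  assume "?S \<noteq> \<infinity>"
  then obtain C where C: "C \<ge> 0" "?S = ennreal C"
    by (cases ?S) auto
  \<comment> \<open>\<open>N\<close> will be the number of unit jumps. Passing to
    \<open>C + 1\<close> makes \<open>N\<close> to the power \<open>1 / r\<close> exceed
    \<open>C\<close> strictly.\<close>
  obtain N :: nat where N: "(C + 1) powr r < real N"
    using reals_Archimedean2 by blast
  then have N1: "1 \<le> N"
    using powr_ge_zero[of "C + 1" r] by (cases N) auto
  have "C < ((C + 1) powr r) powr (1 / r)"
    using C(1) \<open>r \<ge> 1\<close> by (simp add: powr_powr)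
  also have "\<dots> \<le> real N powr (1 / r)"
    using N \<open>r \<ge> 1\<close> by (intro powr_mono2) auto
  finally have CN: "C < real N powr (1 / r)" .
  \<comment> \<open>The goal is \<open>4 * N * m \<le> n\<close> with \<open>m\<close> at most
    \<open>b n + 1\<close>. The ratio bound lets \<open>4 * N * b n\<close> use up half of
    \<open>n\<close>, and \<open>8 * N \<le> n\<close> leaves the other half for the rounding term
    \<open>4 * N\<close>.\<close>
  obtain n where n: "n \<ge> 8 * N" "n \<ge> 1" "real n / b n > 8 * real N"
  proof (rule unbounded_image_large[OF assms(3)])
    show "real n / b n \<ge> 0" if "n \<ge> 1" for n
      using assms(2)[OF that] by simp
  qed
  \<comment> \<open>The least integer strictly above \<open>b n\<close>: few zeros keep the
    eigenvalues large, yet the weight \<open>n - m\<close> stays below \<open>n - b n\<close>, so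
    \<open>y\<close> avoids the forbidden frequencies.\<close>
  define m where "m = Suc (nat \<lfloor>b n\<rfloor>)"
  have m: "b n < real m" "real m \<le> b n + 1" "1 \<le> m"
    using assms(2)[OF n(2)] unfolding m_def by linarith+
  have "4 * real N * real m \<le> 4 * real N * (b n + 1)"
    using m(2) by (intro mult_left_mono) auto
  moreover have "8 * real N * b n < real n"
    using n(3) assms(2)[OF n(2)] by (simp add: field_simps)
  moreover have "8 * real N \<le> real n"
    using n(1) by linarith
  ultimately have "4 * real N * real m \<le> real n"
    by (simp add: algebra_simps)
  then have Nm: "4 * N * m \<le> n"
    by (metis of_nat_le_iff of_nat_mult of_nat_numeral)
  have "m \<le> 4 * N * m"
    using N1 by simp
  with Nm have "m \<le> n"
    by linarith
  define y :: "nat \<Rightarrow> nat" where "y = restrict (\<lambda>j. if j \<le> m then 0 else 1) {1..n}"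
  have "weight n y = (\<Sum>j=1..n. if j \<in> {m<..n} then 1 else 0)"
    unfolding weight_def by (intro sum.cong) (auto simp: y_def)
  also have "\<dots> = card ({1..n} \<inter> {m<..n})"
    by (subst sum.inter_restrict[symmetric]) simp_all
  also have "{1..n} \<inter> {m<..n} = {m<..n}"
    by auto
  finally have "weight n y = n - m"
    by simp
  \<comment> \<open>Here \<open>m \<le> n\<close> ensures that the natural number
    \<open>n - m\<close> is not truncated.\<close>
  then have "y \<notin> high_freq b n"
    using m(1) \<open>m \<le> n\<close> by (simp add: high_freq_def of_nat_diff)
  moreover have "y \<in> cube n"
    by (auto simp: y_def cube_def)
  ultimately have adm: "walsh n y \<in> admissible n (high_freq b n)"
    by (intro walsh_admissible) (auto simp: high_freq_def)
  have card: "sqrt (real (card (cube n))) > 0"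
    using cube_nonempty by (simp add: card_gt_0_iff)
  let ?V = "\<lambda>f. l2_norm n (\<lambda>x. variation r {0..n} (\<lambda>k. spherical_mean n k f x))"
  have "real N powr (1 / r) * sqrt (real (card (cube n))) \<le> ?V (walsh n y)"
    using variation_walsh_ge[OF _ m(3) N1 Nm _ y_def] \<open>r \<ge> 1\<close> by (intro l2_norm_ge) auto
  then have "real N powr (1 / r) \<le> ?V (walsh n y) / l2_norm n (walsh n y)"
    using card by (simp only: l2_norm_walsh pos_le_divide_eq)
  with CN have "C < ?V (walsh n y) / l2_norm n (walsh n y)"
    by (rule less_le_trans)
  then have "ennreal C < ennreal (?V (walsh n y) / l2_norm n (walsh n y))"
    using C(1) by (intro ennreal_lessI le_less_trans[OF C(1)])
  also have "\<dots> \<le> (SUP f \<in> admissible n (high_freq b n). ennreal (?V f / l2_norm n f))"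
    by (rule SUP_upper[OF adm])
  also have "\<dots> \<le> ?S"
    using n(2) by (intro SUP_upper) simp
  finally show False
    unfolding C(2) by simp
qed

end
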